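(* For all $\epsilon\in(0,1)$, $$\lim_{n\to\infty}\frac{d_n(\epsilon)}{\sqrt{2n\log(1/\epsilon)}}=1.$$
   Context: For $0\le k\le n$, $p_{n,k}(x):=\binom{n}{k}x^k(1-x)^{n-k}$. Let $\mathcal{P}_n$ be the space of real polynomials of degree at most $n$ with the inner product of $L^2([0,1])$, let $\mathbb{R}^{n+1}$ carry the Euclidean inner product, and let $S_n:\mathbb{R}^{n+1}\to\mathcal{P}_n$ be $S_nu:=\sum_{k=0}^nu_kp_{n,k}$. Let $\sigma_0\ge\sigma_1\ge\cdots\ge\sigma_n>0$ be the singular values of $S_n$ (depending on $n$), i.e. $\sigma_m=\sqrt{\lambda_m}$ where $\lambda_0\ge\cdots\ge\lambda_n>0$ are the eigenvalues of the Gram matrix with entries $\int_0^1p_{n,k}(x)p_{n,\ell}(x)\,dx$, $k,\ell=0,\dots,n$. For $\epsilon\in(0,1)$, $d_n(\epsilon):=\max\{0\le m\le n:\sigma_m\ge\epsilon\sigma_0\}$. $\log$ is the natural logarithm. *)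

theory Defs
  imports
    "HOL-Analysis.Analysis"
    "Jordan_Normal_Form.Char_Poly"
    "HOL-Library.Multiset"
begin

text \<open>
  The basis polynomial $p_{n,k}$ is \<^term>\<open>Bernstein n k\<close>. Since the dimension \<open>n + 1\<close> is the
  variable of the limit, vectors and matrices are those of \<open>Jordan_Normal_Form\<close>.
\<close>

definition L2_inner :: "(real \<Rightarrow> real) \<Rightarrow> (real \<Rightarrow> real) \<Rightarrow> real" where
  "L2_inner f g = integral {0..1} (\<lambda>x. f x * g x)"

definition bernstein_map :: "nat \<Rightarrow> real Matrix.vec \<Rightarrow> real \<Rightarrow> real" where
  "bernstein_map n u = (\<lambda>x. \<Sum>k\<le>n. vec_index u k * Bernstein n k x)"

definition bernstein_gram :: "nat \<Rightarrow> real Matrix.mat" where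
  "bernstein_gram n =
     Matrix.mat (n + 1) (n + 1) (\<lambda>(k, l). L2_inner (Bernstein n k) (Bernstein n l))"

text \<open>
  The Gram matrix represents $S_n^* S_n$, so the square roots of its eigenvalues are the singular
  values of $S_n$.
\<close>

lemma L2_inner_bernstein_map:
  assumes u: "u \<in> carrier_vec (n + 1)" and v: "v \<in> carrier_vec (n + 1)"
  shows "L2_inner (bernstein_map n u) (bernstein_map n v)
    = Matrix.scalar_prod u (mult_mat_vec (bernstein_gram n) v)"
proof -
  have int: "(\<lambda>x. Bernstein n k x * Bernstein n l x) integrable_on {0..1}" for k l
    unfolding Bernstein_def by (intro integrable_continuous_interval continuous_intros)
  have "L2_inner (bernstein_map n u) (bernstein_map n v)
      = integral {0..1} (\<lambda>x. \<Sum>k\<le>n. \<Sum>l\<le>n.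
          (vec_index u k * vec_index v l) * (Bernstein n k x * Bernstein n l x))"
    unfolding L2_inner_def bernstein_map_def sum_product
    by (simp add: mult_ac)
  also have "\<dots> = (\<Sum>k\<le>n. \<Sum>l\<le>n.
      (vec_index u k * vec_index v l) * L2_inner (Bernstein n k) (Bernstein n l))"
    unfolding L2_inner_def
    by (simp add: integral_sum integrable_sum integrable_on_mult_right int)
  also have "\<dots> = (\<Sum>k\<le>n. vec_index u k *
      (\<Sum>l\<le>n. L2_inner (Bernstein n k) (Bernstein n l) * vec_index v l))"
    by (simp add: sum_distrib_left mult_ac)
  also have "\<dots> = Matrix.scalar_prod u (mult_mat_vec (bernstein_gram n) v)"
    using u v
    by (simp add: bernstein_gram_def Matrix.scalar_prod_def atLeast0LessThan
        flip: lessThan_Suc_atMost)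
  finally show ?thesis .
qed

text \<open>
  The real roots of the characteristic polynomial, listed with multiplicity in decreasing order.
  For a symmetric matrix of dimension \<open>d\<close>, as here, this list has length \<open>d\<close> and the
  multiplicities are also the dimensions of the eigenspaces.
\<close>

definition decreasing_eigenvalues :: "real Matrix.mat \<Rightarrow> real list" where
  "decreasing_eigenvalues A = rev (sorted_list_of_multiset (proots (char_poly A)))"

definition bernstein_singular_value :: "nat \<Rightarrow> nat \<Rightarrow> real" where
  "bernstein_singular_value n m = sqrt (decreasing_eigenvalues (bernstein_gram n) ! m)"

definition bernstein_cutoff :: "nat \<Rightarrow> real \<Rightarrow> nat" where
  "bernstein_cutoff n \<epsilon> =
     Max {m. m \<le> n \<and> bernstein_singular_value n m \<ge> \<epsilon> * bernstein_singular_value n 0}"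

end

theory Submission
  imports Defs "HOL-Real_Asymp.Real_Asymp"
begin

text \<open>
  Let \<open>V\<close> be the unitriangular matrix with entries \<open>l choose j\<close>. Since
  \<open>(\<Sum>l\<le>n. (l choose j) * Bernstein n l x) = (n choose j) * x ^ j\<close>, a Beta integral shows that the
  Gram matrix sends the \<open>j\<close>-th column of \<open>V\<close> to a multiple of the vector with entries
  \<open>k + j choose j\<close>, which by Vandermonde is a combination of the columns \<open>0, \<dots>, j\<close>. Hence the Gram
  matrix is similar to a triangular matrix, whose diagonal entries
  \<open>\<lambda>\<^sub>m = (n!)\<^sup>2 / ((n - m)! (n + m + 1)!)\<close> are the eigenvalues. Taking logarithms,
  \<open>m\<^sup>2 / (n + 1) \<le> ln (\<lambda>\<^sub>0 / \<lambda>\<^sub>m) \<le> (m + 1)\<^sup>2 / (n + 1 - m)\<close>, so the cutoff is squeezed around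
  \<open>sqrt (2 n ln (1 / \<epsilon>))\<close>.
\<close>

section \<open>Beta integrals and binomial moments of Bernstein polynomials\<close>

lemma has_integral_power_mult_power:
  "((\<lambda>x::real. x ^ a * (1 - x) ^ b) has_integral (fact a * fact b / fact (a + b + 1))) {0..1}"
proof -
  have "Beta (real a + 1) (real b + 1) = fact a * fact b / fact (a + b + 1)"
    using Gamma_fact[of a, where 'a = real] Gamma_fact[of b, where 'a = real]
      Gamma_fact[of "a + b + 1", where 'a = real]
    by (simp add: Beta_def add_ac)
  moreover have "((\<lambda>x. x powr (real a + 1 - 1) * (1 - x) powr (real b + 1 - 1)) has_integral
      Beta (real a + 1) (real b + 1)) {0..1}"
    by (rule has_integral_Beta_real) auto
  ultimately have "((\<lambda>x. x powr (real a + 1 - 1) * (1 - x) powr (real b + 1 - 1)) has_integral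
      (fact a * fact b / fact (a + b + 1))) {0..1}"
    by simp
  then show ?thesis
    \<comment> \<open>The endpoints are exempted because \<open>0 powr 0 = 0\<close> while
      \<open>0 ^ 0 = 1\<close>, so the integrands can differ there.\<close>
    by (rule has_integral_spike_finite[where S = "{0, 1}", rotated 2])
      (auto simp: powr_realpow)
qed

text \<open>The identity \<open>choose_mult\<close> moves \<open>n choose j\<close> out of the
  product of binomial coefficients. What remains is the sum of all Bernstein polynomials of degree
  \<open>n - j\<close>, which is 1. These are the factorial moments of the binomial distribution,
  divided by \<open>fact j\<close>.\<close>

lemma sum_choose_Bernstein:
  assumes "j \<le> n"
  shows "(\<Sum>l\<le>n. real (l choose j) * Bernstein n l x) = real (n choose j) * x ^ j"
proof -
  have "(\<Sum>l\<le>n. real (l choose j) * Bernstein n l x)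
      = (\<Sum>l\<in>{j..n}. real (l choose j) * Bernstein n l x)"
    by (rule sum.mono_neutral_right) (auto simp: binomial_eq_0)
  also have "\<dots> = (\<Sum>i\<le>n - j. real (n choose j) * x ^ j * Bernstein (n - j) i x)"
  proof (rule sum.reindex_bij_witness[where i = "\<lambda>i. i + j" and j = "\<lambda>l. l - j"])
    fix l assume l: "l \<in> {j..n}"
    then have "real (n choose l) * real (l choose j) = real (n choose j) * real (n - j choose (l - j))"
      using choose_mult[of j l n] by (metis atLeastAtMost_iff of_nat_mult)
    moreover have "x ^ j * x ^ (l - j) = x ^ l" and "n - j - (l - j) = n - l"
      using l by (simp_all flip: power_add)
    ultimately show "real (n choose j) * x ^ j * Bernstein (n - j) (l - j) x
        = real (l choose j) * Bernstein n l x"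
      unfolding Bernstein_def by (metis mult.assoc mult.commute)
  qed (use assms in auto)
  also have "\<dots> = real (n choose j) * x ^ j"
    by (simp flip: sum_distrib_left)
  finally show ?thesis .
qed

text \<open>Summing over \<open>l\<close> under the integral leaves a single Beta integral. Its
  factor \<open>fact (k + j)\<close> combines with the \<open>fact k\<close> in the denominator of
  \<open>n choose k\<close>, so \<open>k\<close> survives only in a binomial coefficient.\<close>

lemma sum_L2_inner_Bernstein_choose:
  assumes "k \<le> n" "j \<le> n"
  shows "(\<Sum>l\<le>n. L2_inner (Bernstein n k) (Bernstein n l) * real (l choose j))
    = real (n choose j) * fact n * fact j / fact (n + j + 1) * real ((k + j) choose j)"
proof -
  have int: "(\<lambda>x. Bernstein n k x * Bernstein n l x) integrable_on {0..1}" for l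
    unfolding Bernstein_def by (intro integrable_continuous_interval continuous_intros)
  have "(\<Sum>l\<le>n. L2_inner (Bernstein n k) (Bernstein n l) * real (l choose j))
      = integral {0..1} (\<lambda>x. \<Sum>l\<le>n. Bernstein n k x * Bernstein n l x * real (l choose j))"
    unfolding L2_inner_def by (simp add: integral_sum integrable_on_mult_left int)
  also have "(\<lambda>x. \<Sum>l\<le>n. Bernstein n k x * Bernstein n l x * real (l choose j))
      = (\<lambda>x. real (n choose j) * real (n choose k) * (x ^ (k + j) * (1 - x) ^ (n - k)))"
  proof
    fix x
    have "(\<Sum>l\<le>n. Bernstein n k x * Bernstein n l x * real (l choose j))
        = Bernstein n k x * (\<Sum>l\<le>n. real (l choose j) * Bernstein n l x)"
      by (simp add: sum_distrib_left mult_ac)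
    also have "\<dots> = real (n choose j) * real (n choose k) * (x ^ (k + j) * (1 - x) ^ (n - k))"
      unfolding sum_choose_Bernstein[OF assms(2)] by (simp add: Bernstein_def power_add mult_ac)
    finally show "(\<Sum>l\<le>n. Bernstein n k x * Bernstein n l x * real (l choose j))
      = real (n choose j) * real (n choose k) * (x ^ (k + j) * (1 - x) ^ (n - k))" .
  qed
  also have "integral {0..1} \<dots> = real (n choose j) * real (n choose k) *
      (fact (k + j) * fact (n - k) / fact (n + j + 1))"
  proof -
    have "k + j + (n - k) + 1 = n + j + 1"
      using assms(1) by simp
    then show ?thesis
      using has_integral_power_mult_power[of "k + j" "n - k"]
      by (intro integral_unique has_integral_mult_right) (simp only:)
  qed
  also have "\<dots> = real (n choose j) * fact n * fact j / fact (n + j + 1) * real ((k + j) choose j)"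
    using assms(1) by (simp add: binomial_fact field_simps)
  finally show ?thesis .
qed

section \<open>Triangular form and spectrum of the Gram matrix\<close>

definition gram_eigenvalue :: "nat \<Rightarrow> nat \<Rightarrow> real" where
  "gram_eigenvalue n m = (fact n)\<^sup>2 / (fact (n - m) * fact (n + m + 1))"

definition choose_mat :: "nat \<Rightarrow> real Matrix.mat" where
  "choose_mat n = Matrix.mat (n + 1) (n + 1) (\<lambda>(l, j). real (l choose j))"

text \<open>Column \<open>j\<close> holds the coordinates of the image of column \<open>j\<close> of
  \<open>choose_mat n\<close> in the basis of all its columns. The entries below the diagonal vanish
  since \<open>j choose i = 0\<close> for \<open>i > j\<close>.\<close>

definition gram_triangular :: "nat \<Rightarrow> real Matrix.mat" where
  "gram_triangular n = Matrix.mat (n + 1) (n + 1)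
     (\<lambda>(i, j). gram_eigenvalue n j * real (j choose i))"

lemma bernstein_gram_mult_choose_mat:
  "bernstein_gram n * choose_mat n = choose_mat n * gram_triangular n"
proof (rule eq_matI)
  fix k j assume "k < dim_row (choose_mat n * gram_triangular n)"
    "j < dim_col (choose_mat n * gram_triangular n)"
  then have kj: "k \<le> n" "j \<le> n"
    by (auto simp: choose_mat_def gram_triangular_def)
  \<comment> \<open>Terms with \<open>i > j\<close> vanish, and the symmetry of
    \<open>j choose i\<close> gives the convolution form that Vandermonde needs.\<close>
  have "(\<Sum>i\<le>n. (k choose i) * (j choose i)) = (\<Sum>i\<le>j. (k choose i) * (j choose (j - i)))"
    using kj by (intro sum.mono_neutral_cong_right)
      (auto simp: binomial_eq_0 simp flip: binomial_symmetric)
  then have *: "(\<Sum>i\<le>n. (k choose i) * (j choose i)) = (k + j) choose j"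
    by (simp add: vandermonde)
  have "real (n choose j) * fact n * fact j / fact (n + j + 1) = gram_eigenvalue n j"
    using kj by (simp add: gram_eigenvalue_def binomial_fact field_simps power2_eq_square)
  then have "(\<Sum>l\<le>n. L2_inner (Bernstein n k) (Bernstein n l) * real (l choose j))
      = gram_eigenvalue n j * real (\<Sum>i\<le>n. (k choose i) * (j choose i))"
    using sum_L2_inner_Bernstein_choose[OF kj] * by simp
  also have "\<dots> = (\<Sum>i\<le>n. real (k choose i) * (gram_eigenvalue n j * real (j choose i)))"
    by (simp add: sum_distrib_left mult_ac)
  finally show "(bernstein_gram n * choose_mat n) $$ (k, j)
      = (choose_mat n * gram_triangular n) $$ (k, j)"
    using kj
    by (simp add: bernstein_gram_def choose_mat_def gram_triangular_def Matrix.scalar_prod_def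
        atLeast0LessThan flip: lessThan_Suc_atMost)
qed (auto simp: bernstein_gram_def choose_mat_def gram_triangular_def)

lemma similar_mat_intertwine:
  fixes A B P :: "'a :: field mat"
  assumes "A \<in> carrier_mat n n" "B \<in> carrier_mat n n" "P \<in> carrier_mat n n"
    and "det P \<noteq> 0" and "A * P = P * B"
  shows "similar_mat A B"
proof -
  obtain Q where Q: "Q \<in> carrier_mat n n" "P * Q = 1\<^sub>m n" "Q * P = 1\<^sub>m n"
    \<comment> \<open>The value \<open>()\<close> fills the otherwise undetermined record extension
      of \<open>ring_mat\<close>.\<close>
    using det_non_zero_imp_unit[OF assms(3,4), of "()"]
    by (auto simp: Units_def ring_mat_def)
  have "P * B * Q = A"
    using assms Q by (metis assoc_mult_mat right_mult_one_mat)
  then show ?thesis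
    using assms Q by (intro similar_matI[of A B P Q n]) auto
qed

lemma det_choose_mat: "det (choose_mat n) = 1"
proof -
  have "det (choose_mat n) = prod_list (diag_mat (choose_mat n))"
    by (rule det_lower_triangular[of "n + 1"]) (auto simp: choose_mat_def binomial_eq_0)
  also have "\<dots> = 1"
    unfolding prod_list_diag_prod by (rule prod.neutral) (auto simp: choose_mat_def)
  finally show ?thesis .
qed

lemma char_poly_bernstein_gram:
  "char_poly (bernstein_gram n) = (\<Prod>m\<leftarrow>[0..<n + 1]. [:- gram_eigenvalue n m, 1:])"
proof -
  have carr: "gram_triangular n \<in> carrier_mat (n + 1) (n + 1)"
    by (simp add: gram_triangular_def)
  have "similar_mat (bernstein_gram n) (gram_triangular n)"
    using bernstein_gram_mult_choose_mat carr
    by (intro similar_mat_intertwine[where P = "choose_mat n" and n = "n + 1"])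
      (simp_all add: det_choose_mat, simp_all add: bernstein_gram_def choose_mat_def)
  then have "char_poly (bernstein_gram n) = char_poly (gram_triangular n)"
    by (rule char_poly_similar)
  also have "\<dots> = (\<Prod>a\<leftarrow>diag_mat (gram_triangular n). [:- a, 1:])"
    by (rule char_poly_upper_triangular[OF carr]) (auto simp: gram_triangular_def binomial_eq_0)
  also have "diag_mat (gram_triangular n) = map (gram_eigenvalue n) [0..<n + 1]"
    by (auto simp: diag_mat_def gram_triangular_def)
  finally show ?thesis
    by (simp add: o_def)
qed

lemma gram_eigenvalue_pos: "gram_eigenvalue n m > 0"
  by (simp add: gram_eigenvalue_def)

lemma gram_eigenvalue_Suc:
  assumes "m < n"
  shows "gram_eigenvalue n (Suc m) = gram_eigenvalue n m * (real (n - m) / real (n + m + 2))"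
proof -
  have "fact (n - m) = real (n - m) * fact (n - Suc m)"
    using assms by (metis Suc_diff_Suc fact_Suc of_nat_mult of_nat_fact)
  moreover have "fact (n + Suc m + 1) = real (n + m + 2) * fact (n + m + 1)"
    by (simp add: algebra_simps)
  moreover have "real (n - m) \<noteq> 0"
    using assms by simp
  ultimately show ?thesis
    unfolding gram_eigenvalue_def by (simp add: divide_simps)
qed

lemma gram_eigenvalue_antimono:
  assumes "i \<le> j" "j \<le> n"
  shows "gram_eigenvalue n j \<le> gram_eigenvalue n i"
  using assms
proof (induction j rule: dec_induct)
  case (step m)
  have "real (n - m) / real (n + m + 2) \<le> 1"
    by simp
  then have "gram_eigenvalue n (Suc m) \<le> gram_eigenvalue n m"
    using step gram_eigenvalue_pos[of n m]
    by (subst gram_eigenvalue_Suc) (auto intro: mult_left_le simp del: times_divide_eq_right)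
  then show ?case
    using step by simp
qed simp

lemma decreasing_eigenvalues_bernstein_gram:
  "decreasing_eigenvalues (bernstein_gram n) = map (gram_eigenvalue n) [0..<n + 1]"
proof -
  let ?xs = "map (gram_eigenvalue n) [0..<n + 1]"
  have "proots (\<Prod>m\<leftarrow>ms. [:- gram_eigenvalue n m, 1:]) = mset (map (gram_eigenvalue n) ms)" for ms
    by (induction ms) (simp_all add: proots_mult prod_list_zero_iff image_iff del: mult_pCons_left)
  then have "proots (char_poly (bernstein_gram n)) = mset ?xs"
    unfolding char_poly_bernstein_gram .
  \<comment> \<open>The eigenvalues are non-increasing in \<open>m\<close>, so the reversed list is
    its own sorted form, and the \<open>rev\<close> in \<open>decreasing_eigenvalues\<close> undoes
    the reversal.\<close>
  also have "\<dots> = mset (rev ?xs)"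
    by simp
  finally have "sorted_list_of_multiset (proots (char_poly (bernstein_gram n))) = sort (rev ?xs)"
    by (simp only: sorted_list_of_multiset_mset)
  also have "sort (rev ?xs) = rev ?xs"
  proof (rule sorted_sort_id)
    show "sorted (rev ?xs)"
      unfolding sorted_rev_iff_nth_mono by (auto intro!: gram_eigenvalue_antimono simp del: upt_Suc)
  qed
  finally show ?thesis
    by (simp add: decreasing_eigenvalues_def)
qed

section \<open>Logarithmic estimates for eigenvalue ratios\<close>

text \<open>The difference of the two sides vanishes at 0 and has derivative
  \<open>2 / ((1 + t) * (1 - t)) - 2\<close>, which is nonnegative on the interval.\<close>

lemma ln_ratio_ge:
  fixes x :: real
  assumes "0 \<le> x" "x < 1"
  shows "2 * x \<le> ln ((1 + x) / (1 - x))"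
proof -
  let ?f = "\<lambda>t::real. ln (1 + t) - ln (1 - t) - 2 * t"
  have "?f 0 \<le> ?f x"
  proof (rule DERIV_nonneg_imp_nondecreasing[OF assms(1)])
    fix t :: real assume t: "0 \<le> t" "t \<le> x"
    have "(?f has_real_derivative 1 / (1 + t) + 1 / (1 - t) - 2) (at t)"
      using t assms by (auto intro!: derivative_eq_intros)
    moreover have "1 / (1 + t) + 1 / (1 - t) - 2 \<ge> 0"
    proof -
      have "0 < (1 + t) * (1 - t)"
        using t assms by (intro mult_pos_pos) auto
      moreover have "(1 + t) * (1 - t) \<le> 1"
        by (simp add: algebra_simps)
      ultimately have "1 \<le> 1 / ((1 + t) * (1 - t))"
        by (simp add: le_divide_eq)
      moreover have "1 / (1 + t) + 1 / (1 - t) = 2 * (1 / ((1 + t) * (1 - t)))"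
        using t assms by (simp add: add_frac_eq)
      ultimately show ?thesis
        by linarith
    qed
    ultimately show "\<exists>y. (?f has_real_derivative y) (at t) \<and> 0 \<le> y"
      by blast
  qed
  then show ?thesis
    using assms by (simp add: ln_div)
qed

lemma ln_gram_eigenvalue_Suc:
  assumes "m < n"
  shows "ln (gram_eigenvalue n m) - ln (gram_eigenvalue n (Suc m))
    = ln (real (n + m + 2) / real (n - m))"
  using assms gram_eigenvalue_pos[of n m]
  by (simp add: gram_eigenvalue_Suc ln_mult ln_div)

text \<open>The logarithm telescopes over successive ratios. The increment at \<open>m\<close> is at
  least \<open>2 * (m + 1) / (n + 1)\<close>, and these bounds add up to the claim.\<close>

lemma ln_gram_eigenvalue_ratio_ge:
  assumes "m \<le> n"
  shows "real m * (real m + 1) / (real n + 1) \<le> ln (gram_eigenvalue n 0) - ln (gram_eigenvalue n m)"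
  using assms
proof (induction m)
  case (Suc m)
  \<comment> \<open>The numbers \<open>n + m + 2\<close> and \<open>n - m\<close> lie symmetrically
    about \<open>n + 1\<close>, at distance \<open>m + 1\<close>.\<close>
  define x where "x = (real m + 1) / (real n + 1)"
  have x: "0 \<le> x" "x < 1"
    using Suc.prems by (auto simp: x_def)
  have "1 + x = real (n + m + 2) / (real n + 1)" "1 - x = real (n - m) / (real n + 1)"
    using Suc.prems by (simp_all add: x_def field_simps of_nat_diff)
  then have "(1 + x) / (1 - x) = real (n + m + 2) / real (n - m)"
    by simp
  then have "2 * x \<le> ln (gram_eigenvalue n m) - ln (gram_eigenvalue n (Suc m))"
    using ln_ratio_ge[OF x] ln_gram_eigenvalue_Suc[of m n] Suc.prems by simp
  moreover have "real (Suc m) * (real (Suc m) + 1) / (real n + 1)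
      = real m * (real m + 1) / (real n + 1) + 2 * x"
    unfolding x_def times_divide_eq_right add_divide_distrib[symmetric] by (simp add: algebra_simps)
  ultimately show ?case
    using Suc by simp
qed simp

text \<open>The same telescoping, now with \<open>ln y \<le> y - 1\<close>. The separate bound
  \<open>M\<close> keeps the denominator fixed during the induction.\<close>

lemma ln_gram_eigenvalue_ratio_le:
  assumes "m \<le> M" "M \<le> n"
  shows "ln (gram_eigenvalue n 0) - ln (gram_eigenvalue n m)
    \<le> real m * (real m + 1) / (real n + 1 - real M)"
  using assms
proof (induction m)
  case (Suc m)
  have "ln (real (n + m + 2) / real (n - m)) \<le> real (n + m + 2) / real (n - m) - 1"
    using Suc.prems by (intro ln_le_minus_one) auto
  also have "\<dots> = (2 * real m + 2) / (real n - real m)"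
    using Suc.prems by (simp add: field_simps of_nat_diff)
  \<comment> \<open>Here \<open>Suc m \<le> M\<close>, hence
    \<open>n - m \<ge> n + 1 - M > 0\<close>.\<close>
  also have "\<dots> \<le> (2 * real m + 2) / (real n + 1 - real M)"
    using Suc.prems by (intro divide_left_mono mult_pos_pos) auto
  finally have "ln (gram_eigenvalue n m) - ln (gram_eigenvalue n (Suc m))
      \<le> (2 * real m + 2) / (real n + 1 - real M)"
    using ln_gram_eigenvalue_Suc[of m n] Suc.prems by simp
  moreover have "real (Suc m) * (real (Suc m) + 1) / (real n + 1 - real M)
      = real m * (real m + 1) / (real n + 1 - real M) + (2 * real m + 2) / (real n + 1 - real M)"
    by (simp add: add_divide_distrib[symmetric] algebra_simps)
  ultimately show ?case
    using Suc by simp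
qed simp

section \<open>Bounds for the cutoff and the limit\<close>

lemma bernstein_singular_value_ge_iff:
  assumes "m \<le> n" "0 < \<epsilon>"
  shows "bernstein_singular_value n m \<ge> \<epsilon> * bernstein_singular_value n 0
    \<longleftrightarrow> ln (gram_eigenvalue n 0) - ln (gram_eigenvalue n m) \<le> 2 * ln (1 / \<epsilon>)"
proof -
  have sv: "bernstein_singular_value n i = sqrt (gram_eigenvalue n i)" if "i \<le> n" for i
    using that unfolding bernstein_singular_value_def decreasing_eigenvalues_bernstein_gram
    by (simp del: upt_Suc)
  have pos: "sqrt (gram_eigenvalue n i) > 0" for i
    using gram_eigenvalue_pos by simp
  have "bernstein_singular_value n m \<ge> \<epsilon> * bernstein_singular_value n 0
      \<longleftrightarrow> ln (\<epsilon> * sqrt (gram_eigenvalue n 0)) \<le> ln (sqrt (gram_eigenvalue n m))"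
    using assms pos by (simp add: sv)
  also have "\<dots> \<longleftrightarrow> ln (gram_eigenvalue n 0) - ln (gram_eigenvalue n m) \<le> 2 * ln (1 / \<epsilon>)"
  proof -
    have half: "ln (sqrt (gram_eigenvalue n i)) = ln (gram_eigenvalue n i) / 2" for i
      by (intro ln_sqrt less_imp_le gram_eigenvalue_pos)
    have "ln (\<epsilon> * sqrt (gram_eigenvalue n 0)) = ln \<epsilon> + ln (sqrt (gram_eigenvalue n 0))"
      using assms pos[of 0] by (intro ln_mult_pos) auto
    moreover have "ln (1 / \<epsilon>) = - ln \<epsilon>"
      using assms by (simp add: ln_div)
    ultimately show ?thesis
      by (simp only: half) linarith
  qed
  finally show ?thesis .
qed

text \<open>The cutoff \<open>d\<close> meets the threshold, so the lower estimate of the log ratio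
  bounds it above. By maximality \<open>d + 1\<close> misses the threshold, so the upper estimate
  bounds \<open>d\<close> below.\<close>

lemma bernstein_cutoff_bounds:
  assumes "0 < \<epsilon>" "\<epsilon> < 1"
  defines "L \<equiv> ln (1 / \<epsilon>)"
  assumes large: "2 * L * (real n + 1) < (real n)\<^sup>2"
  shows "real (bernstein_cutoff n \<epsilon>) \<le> sqrt (2 * L * (real n + 1))"
    and "sqrt (2 * L * (real n - sqrt (2 * L * (real n + 1)))) - 2 \<le> real (bernstein_cutoff n \<epsilon>)"
proof -
  define S where "S = {m. m \<le> n \<and> bernstein_singular_value n m \<ge> \<epsilon> * bernstein_singular_value n 0}"
  define d where "d = bernstein_cutoff n \<epsilon>"
  have L: "L > 0"
    using assms by (simp add: L_def)
  have S: "m \<in> S \<longleftrightarrow> m \<le> n \<and> ln (gram_eigenvalue n 0) - ln (gram_eigenvalue n m) \<le> 2 * L" for m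
    using bernstein_singular_value_ge_iff[of m n \<epsilon>] assms by (auto simp: S_def)
  have fin: "finite S"
    by (rule finite_subset[of _ "{..n}"]) (auto simp: S_def)
  have d: "d = Max S"
    by (simp add: d_def bernstein_cutoff_def S_def)
  have "0 \<in> S"
    using L by (simp add: S)
  then have "d \<in> S"
    unfolding d using fin by (intro Max_in) auto
  then have dn: "d \<le> n" and dL: "ln (gram_eigenvalue n 0) - ln (gram_eigenvalue n d) \<le> 2 * L"
    by (auto simp: S)
  have "real d * (real d + 1) / (real n + 1) \<le> 2 * L"
    using ln_gram_eigenvalue_ratio_ge[OF dn] dL by simp
  then have "(real d)\<^sup>2 \<le> 2 * L * (real n + 1)"
    by (simp add: field_simps power2_eq_square)
  then have upper: "real d \<le> sqrt (2 * L * (real n + 1))"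
    by (rule real_le_rsqrt)
  \<comment> \<open>The assumption \<open>large\<close> rules out \<open>d = n\<close>; thus
    \<open>Suc d\<close> is still an admissible index and fails only by the threshold.\<close>
  also have "\<dots> < real n"
    using large by (intro real_less_lsqrt) auto
  finally have "d < n"
    by simp
  moreover have "Suc d \<notin> S"
    using Max_ge[OF fin, of "Suc d"] d by auto
  ultimately have "2 * L < ln (gram_eigenvalue n 0) - ln (gram_eigenvalue n (Suc d))"
    by (auto simp: S)
  also have "\<dots> \<le> real (Suc d) * (real (Suc d) + 1) / (real n + 1 - real (Suc d))"
    using \<open>d < n\<close> by (intro ln_gram_eigenvalue_ratio_le) auto
  finally have "2 * L * (real n - real d) < (real d + 1) * (real d + 2)"
    using \<open>d < n\<close> by (simp add: field_simps)
  \<comment> \<open>Completing to a square here is the source of the \<open>- 2\<close> in the lower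
    bound.\<close>
  also have "\<dots> \<le> (real d + 2)\<^sup>2"
    by (simp add: power2_eq_square algebra_simps)
  finally have "2 * L * (real n - real d) \<le> (real d + 2)\<^sup>2"
    by simp
  \<comment> \<open>The upper bound just proved removes \<open>d\<close> from the left-hand side and
    makes the lower bound explicit.\<close>
  moreover have "2 * L * (real n - sqrt (2 * L * (real n + 1))) \<le> 2 * L * (real n - real d)"
    using upper L by (intro mult_left_mono) auto
  ultimately have "sqrt (2 * L * (real n - sqrt (2 * L * (real n + 1)))) \<le> real d + 2"
    by (intro real_le_lsqrt) auto
  with upper show "real (bernstein_cutoff n \<epsilon>) \<le> sqrt (2 * L * (real n + 1))"
    and "sqrt (2 * L * (real n - sqrt (2 * L * (real n + 1)))) - 2 \<le> real (bernstein_cutoff n \<epsilon>)"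
    by (simp_all add: d_def)
qed

theorem theorem10:
  fixes \<epsilon> :: real
  assumes "0 < \<epsilon>" and "\<epsilon> < 1"
  shows "(\<lambda>n::nat. real (bernstein_cutoff n \<epsilon>) / sqrt (2 * real n * ln (1 / \<epsilon>)))
           \<longlonglongrightarrow> 1"
proof -
  define L where "L = ln (1 / \<epsilon>)"
  have L: "L > 0"
    using assms by (simp add: L_def)
  have large: "eventually (\<lambda>n::nat. 2 * L * (real n + 1) < (real n)\<^sup>2) sequentially"
    using L by real_asymp
  have lim_upper:
    "(\<lambda>n::nat. sqrt (2 * L * (real n + 1)) / sqrt (2 * real n * L)) \<longlonglongrightarrow> 1"
    using L by real_asymp
  \<comment> \<open>The inner square root is of order \<open>sqrt n\<close>, negligible against
    \<open>n\<close>, and the constant 2 is negligible against \<open>sqrt n\<close>.\<close>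
  have lim_lower:
    "(\<lambda>n::nat. (sqrt (2 * L * (real n - sqrt (2 * L * (real n + 1)))) - 2) / sqrt (2 * real n * L))
      \<longlonglongrightarrow> 1"
    using L by real_asymp
  have "(\<lambda>n::nat. real (bernstein_cutoff n \<epsilon>) / sqrt (2 * real n * L)) \<longlonglongrightarrow> 1"
  proof (rule tendsto_sandwich[OF _ _ lim_lower lim_upper])
    show "eventually (\<lambda>n. (sqrt (2 * L * (real n - sqrt (2 * L * (real n + 1)))) - 2)
        / sqrt (2 * real n * L) \<le> real (bernstein_cutoff n \<epsilon>) / sqrt (2 * real n * L)) sequentially"
      using large bernstein_cutoff_bounds(2)[OF assms] L unfolding L_def
      by (auto elim!: eventually_mono intro!: divide_right_mono)
    show "eventually (\<lambda>n. real (bernstein_cutoff n \<epsilon>) / sqrt (2 * real n * L)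
        \<le> sqrt (2 * L * (real n + 1)) / sqrt (2 * real n * L)) sequentially"
      using large bernstein_cutoff_bounds(1)[OF assms] L unfolding L_def
      by (auto elim!: eventually_mono intro!: divide_right_mono)
  qed
  then show ?thesis
    by (simp only: L_def)
qed

end
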